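(* Let $\phi(x,y)$ be an $L$-formula, $M$ an $L$-structure, and $M^{*}$ a saturated (i.e. $|M|^{+}$-saturated) elementary extension of $M$. Then the following are equivalent: (i) There exist $a_{i},b_{i}\in M$ for $i<\omega$ such that either $M\models\phi(a_{i},b_{j})$ iff $i\leq j$, for all $i,j<\omega$, or $M\models\phi(a_{i},b_{j})$ iff $i\geq j$, for all $i,j<\omega$. (ii) There exist $a_{i}\in M$ for $i<\omega$ and $b_{i}\in M^{*}$ for $i<\omega$ such that either $M^{*}\models\phi(a_{i},b_{j})$ iff $i\leq j$, for all $i,j<\omega$, or $M^{*}\models\phi(a_{i},b_{j})$ iff $i\geq j$, for all $i,j<\omega$.
   Context: Here $x,y$ are finite tuples of variables, and "$a_i\in M$", "$b_i\in M$", "$b_i\in M^*$" mean that $a_i$, $b_i$ are tuples from the indicated structure of the appropriate lengths $l(x)$, $l(y)$ respectively. *)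

theory Defs
  imports Main
begin

unbundle cardinal_syntax

section \<open>First-order languages and structures\<close>

text \<open>The symbols of a language are sets, not whole types, so that a language may have no
  function (or no relation) symbols. Constants are function symbols of arity 0.\<close>

record ('f, 'r) lang =
  funs :: "'f set"
  rels :: "'r set"
  fun_ar :: "'f \<Rightarrow> nat"
  rel_ar :: "'r \<Rightarrow> nat"

record ('f, 'r, 'a) struc =
  univ :: "'a set"
  fun_int :: "'f \<Rightarrow> 'a list \<Rightarrow> 'a"
  rel_int :: "'r \<Rightarrow> 'a list set"

definition tuples :: "'a set \<Rightarrow> nat \<Rightarrow> 'a list set" where
  "tuples A n = {v. set v \<subseteq> A \<and> length v = n}"

text \<open>Interpretations are total in HOL; only their values at symbols of the language, on
  tuples over the universe of the right length, are meaningful.\<close>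

definition is_struc :: "('f, 'r) lang \<Rightarrow> ('f, 'r, 'a) struc \<Rightarrow> bool" where
  "is_struc L M \<longleftrightarrow> univ M \<noteq> {} \<and>
     (\<forall>f\<in>funs L. \<forall>v\<in>tuples (univ M) (fun_ar L f). fun_int M f v \<in> univ M)"

section \<open>Terms, formulas, satisfaction\<close>

datatype 'f tm = Var nat | Fun 'f "'f tm list"

datatype ('f, 'r) fm =
    Eq "'f tm" "'f tm"
  | Rel 'r "'f tm list"
  | Neg "('f, 'r) fm"
  | Conj "('f, 'r) fm" "('f, 'r) fm"
  | Exists nat "('f, 'r) fm"

primrec is_tm :: "('f, 'r) lang \<Rightarrow> 'f tm \<Rightarrow> bool" where
  "is_tm L (Var n) \<longleftrightarrow> True"
| "is_tm L (Fun f ts) \<longleftrightarrow> f \<in> funs L \<and> length ts = fun_ar L f \<and> list_all (is_tm L) ts"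

primrec is_fm :: "('f, 'r) lang \<Rightarrow> ('f, 'r) fm \<Rightarrow> bool" where
  "is_fm L (Eq s t) \<longleftrightarrow> is_tm L s \<and> is_tm L t"
| "is_fm L (Rel r ts) \<longleftrightarrow> r \<in> rels L \<and> length ts = rel_ar L r \<and> list_all (is_tm L) ts"
| "is_fm L (Neg \<phi>) \<longleftrightarrow> is_fm L \<phi>"
| "is_fm L (Conj \<phi> \<psi>) \<longleftrightarrow> is_fm L \<phi> \<and> is_fm L \<psi>"
| "is_fm L (Exists n \<phi>) \<longleftrightarrow> is_fm L \<phi>"

primrec tm_vars :: "'f tm \<Rightarrow> nat set" where
  "tm_vars (Var n) = {n}"
| "tm_vars (Fun f ts) = \<Union> (set (map tm_vars ts))"

primrec free_vars :: "('f, 'r) fm \<Rightarrow> nat set" where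
  "free_vars (Eq s t) = tm_vars s \<union> tm_vars t"
| "free_vars (Rel r ts) = \<Union> (set (map tm_vars ts))"
| "free_vars (Neg \<phi>) = free_vars \<phi>"
| "free_vars (Conj \<phi> \<psi>) = free_vars \<phi> \<union> free_vars \<psi>"
| "free_vars (Exists n \<phi>) = free_vars \<phi> - {n}"

primrec tm_val :: "('f, 'r, 'a) struc \<Rightarrow> (nat \<Rightarrow> 'a) \<Rightarrow> 'f tm \<Rightarrow> 'a" where
  "tm_val M s (Var n) = s n"
| "tm_val M s (Fun f ts) = fun_int M f (map (tm_val M s) ts)"

primrec sat :: "('f, 'r, 'a) struc \<Rightarrow> (nat \<Rightarrow> 'a) \<Rightarrow> ('f, 'r) fm \<Rightarrow> bool" where
  "sat M s (Eq t u) \<longleftrightarrow> tm_val M s t = tm_val M s u"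
| "sat M s (Rel r ts) \<longleftrightarrow> map (tm_val M s) ts \<in> rel_int M r"
| "sat M s (Neg \<phi>) \<longleftrightarrow> \<not> sat M s \<phi>"
| "sat M s (Conj \<phi> \<psi>) \<longleftrightarrow> sat M s \<phi> \<and> sat M s \<psi>"
| "sat M s (Exists n \<phi>) \<longleftrightarrow> (\<exists>u\<in>univ M. sat M (s(n := u)) \<phi>)"

text \<open>\<open>holds M \<phi> z c\<close> is \<open>M \<Turnstile> \<phi>(c)\<close>, where \<open>\<phi> = \<phi>(z)\<close> for a tuple \<open>z\<close> of distinct variables
  containing all free variables of \<open>\<phi>\<close>, and \<open>c\<close> is a tuple over \<open>M\<close> of the same length.
  The other variables get a junk value, which is irrelevant as they are not free in \<open>\<phi>\<close>.\<close>

definition holds :: "('f, 'r, 'a) struc \<Rightarrow> ('f, 'r) fm \<Rightarrow> nat list \<Rightarrow> 'a list \<Rightarrow> bool" where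
  "holds M \<phi> z c \<longleftrightarrow> sat M (\<lambda>n. the (map_of (zip z c) n)) \<phi>"

section \<open>Elementary extensions\<close>

definition substruc :: "('f, 'r) lang \<Rightarrow> ('f, 'r, 'a) struc \<Rightarrow> ('f, 'r, 'a) struc \<Rightarrow> bool" where
  "substruc L M N \<longleftrightarrow> is_struc L M \<and> is_struc L N \<and> univ M \<subseteq> univ N \<and>
     (\<forall>f\<in>funs L. \<forall>v\<in>tuples (univ M) (fun_ar L f). fun_int M f v = fun_int N f v) \<and>
     (\<forall>r\<in>rels L. \<forall>v\<in>tuples (univ M) (rel_ar L r). v \<in> rel_int M r \<longleftrightarrow> v \<in> rel_int N r)"

definition elem_ext :: "('f, 'r) lang \<Rightarrow> ('f, 'r, 'a) struc \<Rightarrow> ('f, 'r, 'a) struc \<Rightarrow> bool" where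
  "elem_ext L M N \<longleftrightarrow> substruc L M N \<and>
     (\<forall>\<phi> z. is_fm L \<phi> \<and> distinct z \<and> free_vars \<phi> \<subseteq> set z \<longrightarrow>
        (\<forall>c\<in>tuples (univ M) (length z). holds M \<phi> z c \<longleftrightarrow> holds N \<phi> z c))"

section \<open>Saturation\<close>

text \<open>\<open>lang_params L A\<close> is \<open>L\<^sub>A\<close>, the expansion of \<open>L\<close> by a new constant \<open>Inr a\<close> for every
  \<open>a \<in> A\<close>, and \<open>struc_params M\<close> interprets each \<open>Inr a\<close> as \<open>a\<close>.\<close>

definition lang_params :: "('f, 'r) lang \<Rightarrow> 'a set \<Rightarrow> ('f + 'a, 'r) lang" where
  "lang_params L A = \<lparr>funs = Inl ` funs L \<union> Inr ` A, rels = rels L,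
     fun_ar = case_sum (fun_ar L) (\<lambda>a. 0), rel_ar = rel_ar L\<rparr>"

definition struc_params :: "('f, 'r, 'a) struc \<Rightarrow> ('f + 'a, 'r, 'a) struc" where
  "struc_params M = \<lparr>univ = univ M,
     fun_int = case_sum (fun_int M) (\<lambda>a v. a), rel_int = rel_int M\<rparr>"

text \<open>A (partial) 1-type of \<open>M\<close> over \<open>A\<close> in the variable \<open>n\<close>.\<close>

definition is_type ::
  "('f, 'r) lang \<Rightarrow> ('f, 'r, 'a) struc \<Rightarrow> 'a set \<Rightarrow> nat \<Rightarrow> ('f + 'a, 'r) fm set \<Rightarrow> bool" where
  "is_type L M A n p \<longleftrightarrow>
     (\<forall>\<psi>\<in>p. is_fm (lang_params L A) \<psi> \<and> free_vars \<psi> \<subseteq> {n}) \<and>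
     (\<forall>q. finite q \<and> q \<subseteq> p \<longrightarrow> (\<exists>u\<in>univ M. \<forall>\<psi>\<in>q. holds (struc_params M) \<psi> [n] [u]))"

definition saturated :: "('f, 'r) lang \<Rightarrow> 'k rel \<Rightarrow> ('f, 'r, 'a) struc \<Rightarrow> bool" where
  "saturated L \<kappa> M \<longleftrightarrow>
     (\<forall>A n p. A \<subseteq> univ M \<and> |A| <o \<kappa> \<and> is_type L M A n p \<longrightarrow>
        (\<exists>u\<in>univ M. \<forall>\<psi>\<in>p. holds (struc_params M) \<psi> [n] [u]))"

end

theory Submission
  imports Defs "HOL-Library.Ramsey" "HOL-Library.Nat_Bijection"
begin

text \<open>
  A half graph in \<open>M\<close> is one in \<open>Mstar\<close> because the extension is elementary. For the
  converse, let \<open>a i\<close> be in \<open>M\<close> and \<open>b j\<close> in \<open>Mstar\<close> with \<open>\<phi>(a i, b j)\<close> iff \<open>i \<le> j\<close>. For a finite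
  set of indices \<open>i \<le> k\<close>, the truth values of all \<open>\<phi>(a i, b n)\<close> are described by a single formula
  with parameters in \<open>M\<close>, so by elementarity some \<open>c n k\<close> in \<open>M\<close> has the same truth values
  (\<open>finite_approximation\<close>). Nothing is known about \<open>\<phi>(a i, c n k)\<close> for \<open>i > k\<close>, and here
  Ramsey's theorem for triples \<open>n < k < i\<close> helps: after thinning out the indices, this truth value
  is constant on all triples. If it is always false, then letting \<open>k\<close> be the successor of \<open>n\<close> gives
  a half graph with \<open>i \<le> n\<close>; if it is always true, then fixing \<open>n\<close> and varying \<open>k\<close> gives a half
  graph with \<open>i > k\<close> (\<open>half_graph_from_finite_approximations\<close>). So the orientation of the
  half graph may change on the way from \<open>Mstar\<close> to \<open>M\<close>, which is why both statements are
  disjunctions. The case of the other orientation in \<open>Mstar\<close> is the same argument for \<open>\<not> \<phi>\<close>,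
  followed by shifts of the indices that turn strict inequalities into weak ones.
\<close>

section \<open>Half graphs from finite approximations\<close>

text \<open>Ramsey's theorem is applied to triples. The colour of \<open>n < k < i\<close> is the truth value of
  \<open>R i (c n k)\<close>, which is precisely what the choice of \<open>c n k\<close>, prescribed up to \<open>k\<close> only, leaves
  open.\<close>

lemma half_graph_from_finite_approximations:
  fixes R :: "nat \<Rightarrow> 'b \<Rightarrow> bool"
  assumes "\<And>n k. \<exists>b\<in>B. \<forall>i\<le>k. R i b \<longleftrightarrow> i \<le> n"
  shows "\<exists>(h :: nat \<Rightarrow> nat) b. (\<forall>j. b j \<in> B) \<and>
    ((\<forall>i j. R (h i) (b j) \<longleftrightarrow> i \<le> j) \<or> (\<forall>i j. R (h i) (b j) \<longleftrightarrow> i \<ge> j))"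
proof -
  from assms have "\<forall>n k. \<exists>b. b \<in> B \<and> (\<forall>i\<le>k. R i b \<longleftrightarrow> i \<le> n)"
    by blast
  then obtain c where "\<forall>n k. c n k \<in> B \<and> (\<forall>i\<le>k. R i (c n k) \<longleftrightarrow> i \<le> n)"
    unfolding choice_iff by blast
  then have cB: "\<And>n k. c n k \<in> B"
    and c: "\<And>n k i. i \<le> k \<Longrightarrow> R i (c n k) \<longleftrightarrow> i \<le> n"
    by blast+
  define f :: "nat set \<Rightarrow> nat" where
    "f X = (if R (Max X) (c (Min X) (Min (X - {Min X}))) then 1 else 0)" for X
  have "\<exists>Y t. Y \<subseteq> UNIV \<and> infinite Y \<and> t < 2 \<and>
      (\<forall>X. X \<subseteq> Y \<and> finite X \<and> card X = 3 \<longrightarrow> f X = t)"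
    by (rule Ramsey) (auto simp: f_def)
  then obtain Y t where Y: "infinite Y"
    and hom: "\<forall>X. X \<subseteq> Y \<and> finite X \<and> card X = 3 \<longrightarrow> f X = t"
    by metis
  define h where "h = enumerate Y"
  have hY: "h i \<in> Y" for i
    unfolding h_def using Y by (rule enumerate_in_set)
  have less: "h i < h j \<longleftrightarrow> i < j" for i j
    unfolding h_def using Y by (rule enumerate_mono_iff)
  have le: "h i \<le> h j \<longleftrightarrow> i \<le> j" for i j
    unfolding h_def using Y by (rule enumerate_mono_le_iff)
  have triple: "R (h i) (c (h n) (h k)) \<longleftrightarrow> t = 1" if "n < k" "k < i" for n k i
  proof -
    have lt: "h n < h k" "h k < h i"
      using that by (simp_all add: less)
    have "{h n, h k, h i} - {h n} = {h k, h i}"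
      using lt by auto
    moreover have "Min {h n, h k, h i} = h n" "Min {h k, h i} = h k" "Max {h n, h k, h i} = h i"
      using lt by (simp_all add: min_def max_def)
    moreover have "f {h n, h k, h i} = t"
      using lt by (intro hom[rule_format]) (auto simp: hY)
    ultimately show ?thesis
      by (auto simp: f_def split: if_splits)
  qed
  show ?thesis
  proof (cases "t = 1")
    case False
    have "R (h i) (c (h j) (h (Suc j))) \<longleftrightarrow> i \<le> j" for i j
    proof (cases "i \<le> Suc j")
      case True
      then show ?thesis by (simp add: c le)
    next
      case gt: False
      then show ?thesis using triple[of j "Suc j" i] False by simp
    qed
    then have "(\<forall>j. c (h j) (h (Suc j)) \<in> B) \<and>
        (\<forall>i j. R (h i) (c (h j) (h (Suc j))) \<longleftrightarrow> i \<le> j)"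
      using cB by blast
    then show ?thesis
      by (intro exI[of _ h] exI[of _ "\<lambda>j. c (h j) (h (Suc j))"]) blast
  next
    case True
    \<comment> \<open>With \<open>n\<close> fixed as the least index, one obtains \<open>R\<close> iff \<open>i > k\<close> for \<open>i, k > 0\<close>; the shifts
      by 2 and 1 make this \<open>i \<ge> j\<close> for all indices.\<close>
    have "R (h (i + 2)) (c (h 0) (h (Suc j))) \<longleftrightarrow> i \<ge> j" for i j
    proof (cases "i + 2 \<le> Suc j")
      case True
      then show ?thesis using c[of "h (i + 2)" "h (Suc j)" "h 0"] by (simp add: le)
    next
      case gt: False
      then show ?thesis using triple[of 0 "Suc j" "i + 2"] True by simp
    qed
    then have "(\<forall>j. c (h 0) (h (Suc j)) \<in> B) \<and>
        (\<forall>i j. R (h (i + 2)) (c (h 0) (h (Suc j))) \<longleftrightarrow> i \<ge> j)"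
      using cB by blast
    then show ?thesis
      by (intro exI[of _ "\<lambda>i. h (i + 2)"] exI[of _ "\<lambda>j. c (h 0) (h (Suc j))"]) blast
  qed
qed

section \<open>Satisfaction and assignments\<close>

lemma tm_val_cong:
  "(\<And>n. n \<in> tm_vars t \<Longrightarrow> s n = s' n) \<Longrightarrow> tm_val M s t = tm_val M s' t"
proof (induction t)
  case (Fun f ts)
  then have "map (tm_val M s) ts = map (tm_val M s') ts"
    by (auto intro!: map_cong)
  then show ?case by (simp only: tm_val.simps)
qed simp

lemma sat_cong:
  "(\<And>n. n \<in> free_vars \<phi> \<Longrightarrow> s n = s' n) \<Longrightarrow> sat M s \<phi> \<longleftrightarrow> sat M s' \<phi>"
proof (induction \<phi> arbitrary: s s')
  case (Eq t u)
  have "tm_val M s t = tm_val M s' t" "tm_val M s u = tm_val M s' u"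
    by (rule tm_val_cong, use Eq.prems in simp)+
  then show ?case by (simp only: sat.simps)
next
  case (Rel r ts)
  then have "map (tm_val M s) ts = map (tm_val M s') ts"
    by (auto intro!: map_cong tm_val_cong)
  then show ?case by (simp only: sat.simps)
next
  case (Neg \<phi>)
  have "sat M s \<phi> \<longleftrightarrow> sat M s' \<phi>"
    by (rule Neg.IH) (use Neg.prems in simp)
  then show ?case by (simp only: sat.simps)
next
  case (Conj \<phi> \<psi>)
  have "sat M s \<phi> \<longleftrightarrow> sat M s' \<phi>"
    by (rule Conj.IH(1)) (use Conj.prems in simp)
  moreover have "sat M s \<psi> \<longleftrightarrow> sat M s' \<psi>"
    by (rule Conj.IH(2)) (use Conj.prems in simp)
  ultimately show ?case by (simp only: sat.simps)
next
  case (Exists n \<phi>)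
  have "sat M (s(n := u)) \<phi> \<longleftrightarrow> sat M (s'(n := u)) \<phi>" for u
    by (rule Exists.IH) (use Exists.prems in auto)
  then show ?case by simp
qed

lemma finite_tm_vars: "finite (tm_vars t)"
  by (induction t) auto

lemma finite_free_vars: "finite (free_vars \<phi>)"
  by (induction \<phi>) (auto simp: finite_tm_vars)

definition upd :: "(nat \<Rightarrow> 'a) \<Rightarrow> nat list \<Rightarrow> 'a list \<Rightarrow> nat \<Rightarrow> 'a" where
  "upd s z c n = (case map_of (zip z c) n of None \<Rightarrow> s n | Some v \<Rightarrow> v)"

lemma upd_notin: "n \<notin> set z \<Longrightarrow> upd s z c n = s n"
  by (auto simp: upd_def split: option.split dest!: map_of_SomeD set_zip_leftD)

lemma upd_Cons: "n \<notin> set z \<Longrightarrow> upd s (n # z) (u # c) = upd (s(n := u)) z c"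
  by (rule ext) (auto simp: upd_def split: option.split dest!: map_of_SomeD set_zip_leftD)

lemma upd_nth: "distinct z \<Longrightarrow> length c = length z \<Longrightarrow> l < length z \<Longrightarrow> upd s z c (z ! l) = c ! l"
  by (simp add: upd_def map_of_zip_nth)

lemma holds_eq_sat:
  assumes "distinct z" "free_vars \<phi> \<subseteq> set z" "length c = length z"
    and "\<And>l. l < length z \<Longrightarrow> s (z ! l) = c ! l"
  shows "holds M \<phi> z c \<longleftrightarrow> sat M s \<phi>"
  unfolding holds_def
proof (rule sat_cong)
  fix n assume "n \<in> free_vars \<phi>"
  then obtain l where "l < length z" "n = z ! l"
    using assms(2) by (metis in_set_conv_nth subsetD)
  then show "the (map_of (zip z c) n) = s n"
    using assms by (simp add: map_of_zip_nth)
qed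

text \<open>Total assignments into the smaller structure play the role of parameters. In this form
  elementarity can be applied without keeping track of free variables.\<close>

lemma elem_ext_sat:
  assumes "elem_ext L M N" "is_fm L \<phi>" "\<And>n. s n \<in> univ M"
  shows "sat M s \<phi> \<longleftrightarrow> sat N s \<phi>"
proof -
  obtain z where z: "set z = free_vars \<phi>" "distinct z"
    using finite_distinct_list[OF finite_free_vars] by blast
  have "map s z \<in> tuples (univ M) (length z)"
    using assms(3) by (auto simp: tuples_def)
  then have "holds M \<phi> z (map s z) \<longleftrightarrow> holds N \<phi> z (map s z)"
    using assms z unfolding elem_ext_def by (metis order_refl)
  moreover have "holds P \<phi> z (map s z) \<longleftrightarrow> sat P s \<phi>" for P :: "('a, 'b, 'c) struc"
    by (rule holds_eq_sat) (simp_all add: z)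
  ultimately show ?thesis by simp
qed

section \<open>Iterated quantifiers and conjunctions, change of variables\<close>

definition Exs :: "nat list \<Rightarrow> ('f, 'r) fm \<Rightarrow> ('f, 'r) fm" where
  "Exs z \<phi> = foldr Exists z \<phi>"

definition Conjs :: "('f, 'r) fm list \<Rightarrow> ('f, 'r) fm" where
  "Conjs \<phi>s = foldr Conj \<phi>s (Eq (Var 0) (Var 0))"

lemma is_fm_Exs [simp]: "is_fm L (Exs z \<phi>) \<longleftrightarrow> is_fm L \<phi>"
  by (induction z) (auto simp: Exs_def)

lemma is_fm_Conjs [simp]: "is_fm L (Conjs \<phi>s) \<longleftrightarrow> (\<forall>\<phi>\<in>set \<phi>s. is_fm L \<phi>)"
  by (induction \<phi>s) (auto simp: Conjs_def)

lemma sat_Conjs [simp]: "sat M s (Conjs \<phi>s) \<longleftrightarrow> (\<forall>\<phi>\<in>set \<phi>s. sat M s \<phi>)"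
  by (induction \<phi>s) (auto simp: Conjs_def)

lemma tuples_0: "tuples A 0 = {[]}"
  by (auto simp: tuples_def)

lemma bex_tuples_Suc:
  "(\<exists>c\<in>tuples A (Suc n). P c) \<longleftrightarrow> (\<exists>u\<in>A. \<exists>c\<in>tuples A n. P (u # c))"
  by (fastforce simp: tuples_def length_Suc_conv)

lemma sat_Exs:
  "distinct z \<Longrightarrow> sat M s (Exs z \<phi>) \<longleftrightarrow> (\<exists>c\<in>tuples (univ M) (length z). sat M (upd s z c) \<phi>)"
proof (induction z arbitrary: s)
  case Nil
  have "upd s [] [] = s" by (simp add: upd_def fun_eq_iff)
  then show ?case by (simp add: Exs_def tuples_0)
next
  case (Cons n z)
  then show ?case by (simp add: bex_tuples_Suc upd_Cons Exs_def)
qed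

text \<open>This is \<open>\<phi>(z)\<close> for \<open>\<phi> = \<phi>(x)\<close>, written as \<open>\<exists>x. x = z \<and> \<phi>\<close>. Since \<open>\<phi>\<close> itself stays untouched,
  variables bound in \<open>\<phi>\<close> cannot capture \<open>z\<close>; only \<open>x\<close> and \<open>z\<close> have to be disjoint.\<close>

definition change_vars :: "nat list \<Rightarrow> nat list \<Rightarrow> ('f, 'r) fm \<Rightarrow> ('f, 'r) fm" where
  "change_vars x z \<phi> =
     Exs x (Conj (Conjs (map (\<lambda>(u, v). Eq (Var u) (Var v)) (zip x z))) \<phi>)"

lemma is_fm_change_vars [simp]: "is_fm L (change_vars x z \<phi>) \<longleftrightarrow> is_fm L \<phi>"
  by (auto simp: change_vars_def)

lemma sat_change_vars:
  assumes x: "distinct x" and len: "length z = length x" and disj: "set x \<inter> set z = {}"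
    and s: "\<And>n. n \<in> set z \<Longrightarrow> s n \<in> univ M"
  shows "sat M s (change_vars x z \<phi>) \<longleftrightarrow> sat M (upd s x (map s z)) \<phi>"
proof -
  have eqs: "(\<forall>(u, v)\<in>set (zip x z). upd s x c u = upd s x c v) \<longleftrightarrow> c = map s z"
    if c: "c \<in> tuples (univ M) (length x)" for c
  proof -
    have "upd s x c (x ! l) = c ! l" "upd s x c (z ! l) = s (z ! l)" if "l < length x" for l
    proof -
      show "upd s x c (x ! l) = c ! l"
        using that x c by (simp add: upd_nth tuples_def)
      have "z ! l \<notin> set x"
        using that len disj nth_mem[of l z] by auto
      then show "upd s x c (z ! l) = s (z ! l)"
        by (rule upd_notin)
    qed
    then have "(\<forall>(u, v)\<in>set (zip x z). upd s x c u = upd s x c v) \<longleftrightarrow>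
        (\<forall>l<length x. c ! l = s (z ! l))"
      using len list_all2_iff[of "\<lambda>u v. upd s x c u = upd s x c v" x z]
      by (simp add: list_all2_conv_all_nth)
    also have "\<dots> \<longleftrightarrow> c = map s z"
      using c len by (auto simp: tuples_def list_eq_iff_nth_eq)
    finally show ?thesis .
  qed
  have "sat M s (change_vars x z \<phi>) \<longleftrightarrow> (\<exists>c\<in>tuples (univ M) (length x).
      (\<forall>(u, v)\<in>set (zip x z). upd s x c u = upd s x c v) \<and> sat M (upd s x c) \<phi>)"
    unfolding change_vars_def using x by (auto simp: sat_Exs split_beta)
  also have "\<dots> \<longleftrightarrow> (\<exists>c\<in>tuples (univ M) (length x). c = map s z \<and> sat M (upd s x c) \<phi>)"
    using eqs by (intro bex_cong refl) simp
  also have "\<dots> \<longleftrightarrow> sat M (upd s x (map s z)) \<phi>"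
    using s len by (auto simp: tuples_def)
  finally show ?thesis .
qed

section \<open>Finite approximations in an elementary substructure\<close>

text \<open>The formula \<open>\<exists>y. \<And>i\<le>k. \<plusminus>\<phi>(a i, y)\<close>, with signs read off from \<open>c\<close>, holds in the extension. The
  \<open>a i\<close> are the values, under a fixed assignment \<open>s\<close>, of pairwise disjoint tuples \<open>v i\<close> of fresh
  variables.\<close>

lemma finite_approximation:
  fixes M N :: "('f, 'r, 'a) struc" and a :: "nat \<Rightarrow> 'a list"
  assumes ext: "elem_ext L M N" and fm: "is_fm L \<phi>"
    and dist: "distinct (x @ y)" and fv: "free_vars \<phi> \<subseteq> set (x @ y)"
    and a: "\<And>i. a i \<in> tuples (univ M) (length x)"
    and c: "c \<in> tuples (univ N) (length y)"
  shows "\<exists>b\<in>tuples (univ M) (length y). \<forall>i\<le>k.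
    holds M \<phi> (x @ y) (a i @ b) \<longleftrightarrow> holds N \<phi> (x @ y) (a i @ c)"
proof -
  have M: "univ M \<noteq> {}" and sub: "univ M \<subseteq> univ N"
    using ext by (auto simp: elem_ext_def substruc_def is_struc_def)
  then obtain u where u: "u \<in> univ M" by blast
  obtain K where K: "\<And>n. n \<in> set (x @ y) \<Longrightarrow> n < K"
    using finite_nat_set_iff_bounded[of "set (x @ y)"] by blast
  define v where "v i = map (\<lambda>l. K + prod_encode (i, l)) [0..<length x]" for i
  define s where
    "s n = (case prod_decode (n - K) of (i, l) \<Rightarrow> if l < length x then a i ! l else u)" for n
  have sM: "s n \<in> univ M" for n
  proof -
    obtain i l where "prod_decode (n - K) = (i, l)" by fastforce
    then show ?thesis
      using u a[of i] by (auto simp: s_def tuples_def)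
  qed
  have sv: "map s (v i) = a i" for i
    using a[of i] by (intro nth_equalityI) (simp_all add: v_def s_def tuples_def)
  have disj: "set (x @ y) \<inter> set (v i) = {}" for i
    using K by (fastforce simp: v_def)
  have sat_v: "sat P (upd s y d) (change_vars x (v i) \<phi>) \<longleftrightarrow> holds P \<phi> (x @ y) (a i @ d)"
    if P: "univ M \<subseteq> univ P" and d: "d \<in> tuples (univ P) (length y)"
    for P :: "('f, 'r, 'a) struc" and d i
  proof -
    have upd_v: "upd s y d n = s n" if "n \<in> set (v i)" for n
      using that disj[of i] by (intro upd_notin) auto
    then have *: "map (upd s y d) (v i) = a i"
      using sv[of i] by (metis map_cong)
    have "sat P (upd s y d) (change_vars x (v i) \<phi>) \<longleftrightarrow>
        sat P (upd (upd s y d) x (map (upd s y d) (v i))) \<phi>"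
    proof (rule sat_change_vars)
      show "upd s y d n \<in> univ P" if "n \<in> set (v i)" for n
        using upd_v[OF that] sM[of n] P by auto
    qed (use dist disj[of i] in \<open>auto simp: v_def\<close>)
    also have "\<dots> \<longleftrightarrow> sat P (upd (upd s y d) x (a i)) \<phi>"
      by (simp only: *)
    also have "\<dots> \<longleftrightarrow> holds P \<phi> (x @ y) (a i @ d)"
    proof (rule holds_eq_sat[symmetric])
      have len: "length (a i) = length x" "length d = length y"
        using a[of i] d by (simp_all add: tuples_def)
      then show "length (a i @ d) = length (x @ y)" by simp
      fix l assume l: "l < length (x @ y)"
      show "upd (upd s y d) x (a i) ((x @ y) ! l) = (a i @ d) ! l"
      proof (cases "l < length x")
        case True
        then show ?thesis
          using dist len by (simp add: nth_append upd_nth)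
      next
        case False
        then have "y ! (l - length x) \<in> set y"
          using l by auto
        then have "y ! (l - length x) \<notin> set x"
          using dist by auto
        then show ?thesis
          using False l dist len by (simp add: nth_append upd_nth upd_notin)
      qed
    qed (use dist fv in auto)
    finally show ?thesis .
  qed
  define \<psi> where "\<psi> i = (if holds N \<phi> (x @ y) (a i @ c) then change_vars x (v i) \<phi>
    else Neg (change_vars x (v i) \<phi>))" for i
  define \<chi> where "\<chi> = Exs y (Conjs (map \<psi> [0..<Suc k]))"
  have sat_\<psi>: "sat P (upd s y d) (\<psi> i) \<longleftrightarrow>
      (holds P \<phi> (x @ y) (a i @ d) \<longleftrightarrow> holds N \<phi> (x @ y) (a i @ c))"
    if "univ M \<subseteq> univ P" "d \<in> tuples (univ P) (length y)"
    for P :: "('f, 'r, 'a) struc" and d i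
    using sat_v[OF that] by (simp add: \<psi>_def)
  have y: "distinct y" using dist by simp
  have "sat N s \<chi>"
    unfolding \<chi>_def sat_Exs[OF y] sat_Conjs using c by (intro bexI[of _ c]) (auto simp: sat_\<psi> sub)
  moreover have "is_fm L \<chi>"
    using fm by (auto simp: \<chi>_def \<psi>_def)
  ultimately have "sat M s \<chi>"
    using elem_ext_sat[of L M N \<chi> s] ext sM by blast
  then obtain b where b: "b \<in> tuples (univ M) (length y)"
    and "\<forall>\<theta>\<in>set (map \<psi> [0..<Suc k]). sat M (upd s y b) \<theta>"
    unfolding \<chi>_def sat_Exs[OF y] sat_Conjs by blast
  then have "sat M (upd s y b) (\<psi> i)" if "i \<le> k" for i
    using that by auto
  then show ?thesis
    using b sat_\<psi>[OF order_refl b] by blast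
qed

section \<open>The order property\<close>

text \<open>The previous combinatorial lemma starts from the orientation \<open>i \<le> j\<close>. The other one is
  reduced to it by negation: \<open>\<not> (i \<ge> Suc n)\<close> means \<open>i \<le> n\<close>. This works because the conclusion
  allows both orientations, up to a shift of indices. In the application \<open>R\<close> and \<open>S\<close> are the
  relations defined by \<open>\<phi>\<close> in the small and in the large structure.\<close>

lemma half_graph_descends:
  fixes R :: "'b \<Rightarrow> 'c \<Rightarrow> bool" and S :: "'b \<Rightarrow> 'd \<Rightarrow> bool" and a :: "nat \<Rightarrow> 'b"
  assumes approx: "\<And>j k. \<exists>b\<in>B. \<forall>i\<le>k. R (a i) b \<longleftrightarrow> S (a i) (c j)"
    and half: "(\<forall>i j. S (a i) (c j) \<longleftrightarrow> i \<le> j) \<or> (\<forall>i j. S (a i) (c j) \<longleftrightarrow> i \<ge> j)"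
  shows "\<exists>(h :: nat \<Rightarrow> nat) b. (\<forall>j. b j \<in> B) \<and>
    ((\<forall>i j. R (a (h i)) (b j) \<longleftrightarrow> i \<le> j) \<or> (\<forall>i j. R (a (h i)) (b j) \<longleftrightarrow> i \<ge> j))"
  using half
proof
  assume "\<forall>i j. S (a i) (c j) \<longleftrightarrow> i \<le> j"
  then show ?thesis
    using approx by (intro half_graph_from_finite_approximations) simp
next
  assume S: "\<forall>i j. S (a i) (c j) \<longleftrightarrow> i \<ge> j"
  have "\<exists>b\<in>B. \<forall>i\<le>k. \<not> R (a i) b \<longleftrightarrow> i \<le> n" for n k
  proof -
    obtain b where "b \<in> B" "\<forall>i\<le>k. R (a i) b \<longleftrightarrow> S (a i) (c (Suc n))"
      using approx by blast
    then show ?thesis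
      using S by (intro bexI[of _ b]) (auto simp: not_less_eq_eq)
  qed
  from half_graph_from_finite_approximations[of B "\<lambda>i b. \<not> R (a i) b", OF this]
  obtain h :: "nat \<Rightarrow> nat" and b where b: "\<forall>j. b j \<in> B"
    and "(\<forall>i j. \<not> R (a (h i)) (b j) \<longleftrightarrow> i \<le> j) \<or> (\<forall>i j. \<not> R (a (h i)) (b j) \<longleftrightarrow> i \<ge> j)"
    by blast
  then consider "\<And>i j. R (a (h i)) (b j) \<longleftrightarrow> i > j" | "\<And>i j. R (a (h i)) (b j) \<longleftrightarrow> i < j"
    by (metis linorder_not_le)
  then show ?thesis
  proof cases
    case 1
    then have "\<forall>i j. R (a (h (Suc i))) (b j) \<longleftrightarrow> i \<ge> j"
      by auto
    then show ?thesis
      using b by (intro exI[of _ "\<lambda>i. h (Suc i)"] exI[of _ b]) blast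
  next
    case 2
    then have "\<forall>i j. R (a (h i)) (b (Suc j)) \<longleftrightarrow> i \<le> j"
      by auto
    then show ?thesis
      using b by (intro exI[of _ h] exI[of _ "\<lambda>j. b (Suc j)"]) blast
  qed
qed

theorem lemma2p6:
  fixes L :: "('f, 'r) lang"
    and M Mstar :: "('f, 'r, 'a) struc"
    and \<phi> :: "('f, 'r) fm"
    and x y :: "nat list"
  assumes "is_fm L \<phi>"
    and "distinct (x @ y)"
    and "free_vars \<phi> \<subseteq> set (x @ y)"
    and "is_struc L M"
    and "elem_ext L M Mstar"
    and "saturated L (cardSuc |univ M| ) Mstar"
  shows "(\<exists>a b :: nat \<Rightarrow> 'a list.
            (\<forall>i. a i \<in> tuples (univ M) (length x)) \<and>
            (\<forall>i. b i \<in> tuples (univ M) (length y)) \<and>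
            ((\<forall>i j. holds M \<phi> (x @ y) (a i @ b j) \<longleftrightarrow> i \<le> j) \<or>
             (\<forall>i j. holds M \<phi> (x @ y) (a i @ b j) \<longleftrightarrow> i \<ge> j)))
     \<longleftrightarrow>
         (\<exists>a b :: nat \<Rightarrow> 'a list.
            (\<forall>i. a i \<in> tuples (univ M) (length x)) \<and>
            (\<forall>i. b i \<in> tuples (univ Mstar) (length y)) \<and>
            ((\<forall>i j. holds Mstar \<phi> (x @ y) (a i @ b j) \<longleftrightarrow> i \<le> j) \<or>
             (\<forall>i j. holds Mstar \<phi> (x @ y) (a i @ b j) \<longleftrightarrow> i \<ge> j)))"
  (is "?inM \<longleftrightarrow> ?inMstar")
proof
  have sub: "univ M \<subseteq> univ Mstar"
    using assms(5) by (simp add: elem_ext_def substruc_def)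
  assume ?inM
  then obtain a b :: "nat \<Rightarrow> 'a list" where a: "\<And>i. a i \<in> tuples (univ M) (length x)"
    and b: "\<And>i. b i \<in> tuples (univ M) (length y)"
    and half: "(\<forall>i j. holds M \<phi> (x @ y) (a i @ b j) \<longleftrightarrow> i \<le> j) \<or>
      (\<forall>i j. holds M \<phi> (x @ y) (a i @ b j) \<longleftrightarrow> i \<ge> j)"
    by blast
  have "a i @ b j \<in> tuples (univ M) (length (x @ y))" for i j
    using a[of i] b[of j] by (auto simp: tuples_def)
  then have "holds M \<phi> (x @ y) (a i @ b j) \<longleftrightarrow> holds Mstar \<phi> (x @ y) (a i @ b j)" for i j
    using assms(1,2,3,5) unfolding elem_ext_def by blast
  moreover have "b i \<in> tuples (univ Mstar) (length y)" for i
    using b[of i] sub by (auto simp: tuples_def)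
  ultimately show ?inMstar
    using a half by (intro exI[of _ a] exI[of _ b]) simp
next
  assume ?inMstar
  then obtain a b :: "nat \<Rightarrow> 'a list" where a: "\<And>i. a i \<in> tuples (univ M) (length x)"
    and b: "\<And>i. b i \<in> tuples (univ Mstar) (length y)"
    and half: "(\<forall>i j. holds Mstar \<phi> (x @ y) (a i @ b j) \<longleftrightarrow> i \<le> j) \<or>
      (\<forall>i j. holds Mstar \<phi> (x @ y) (a i @ b j) \<longleftrightarrow> i \<ge> j)"
    by blast
  have "\<exists>d\<in>tuples (univ M) (length y). \<forall>i\<le>k.
      holds M \<phi> (x @ y) (a i @ d) \<longleftrightarrow> holds Mstar \<phi> (x @ y) (a i @ b j)" for j k
    using assms(5,1,2,3) a b by (rule finite_approximation)
  from half_graph_descends[of "tuples (univ M) (length y)" "\<lambda>u d. holds M \<phi> (x @ y) (u @ d)" a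
      "\<lambda>u d. holds Mstar \<phi> (x @ y) (u @ d)", OF this half]
  obtain h :: "nat \<Rightarrow> nat" and d :: "nat \<Rightarrow> 'a list" where "\<forall>j. d j \<in> tuples (univ M) (length y)"
    and "(\<forall>i j. holds M \<phi> (x @ y) (a (h i) @ d j) \<longleftrightarrow> i \<le> j) \<or>
      (\<forall>i j. holds M \<phi> (x @ y) (a (h i) @ d j) \<longleftrightarrow> i \<ge> j)"
    by blast
  then show ?inM
    using a by (intro exI[of _ "\<lambda>i. a (h i)"] exI[of _ d]) simp
qed

end
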